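(* Let $E \subset \mathbb{R}$ be compact, let $f: E \to \mathbb{R}$, and let $M > 0$. Suppose that for every $S \subset E$ with $\#S \le 5$ there exists a convex function $F^S \in C^{1,1}_c(\mathbb{R})$ satisfying $F^S|_S = f|_S$ and $\mathrm{Lip}(\nabla F^S) \le M$. Then there exists a convex function $F \in C^{1,1}_c(\mathbb{R})$ satisfying $F|_E = f|_E$ and $\mathrm{Lip}(\nabla F) \le 2M$.
   Context: $C^{1,1}_c(\mathbb{R})$ denotes the set of convex, differentiable functions $F:\mathbb{R}\to\mathbb{R}$ whose derivative $\nabla F = F'$ is (globally) Lipschitz continuous. $\mathrm{Lip}(G) = \sup_{x \ne y} |G(x)-G(y)|/|x-y|$. $\#S$ is the cardinality of $S$. *)

theory Defs
  imports "HOL-Analysis.Analysis"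
begin

definition C11c :: "(real \<Rightarrow> real) set" where
  "C11c = {F. convex_on UNIV F \<and> F differentiable_on UNIV
              \<and> (\<exists>L. L-lipschitz_on UNIV (deriv F))}"

(* Extended-real valued, so that the supremum is meaningful also for G that are not Lipschitz. *)
definition Lip :: "(real \<Rightarrow> real) \<Rightarrow> ereal" where
  "Lip G = (SUP (x, y) \<in> {(x, y). x \<noteq> y}. ereal (\<bar>G x - G y\<bar> / \<bar>x - y\<bar>))"

end

theory Submission
  imports Defs
begin

text \<open>
  A convex function whose derivative has Lipschitz constant at most \<open>K\<close> is a function with curvature
  between \<open>0\<close> and \<open>K\<close>. On the line, values \<open>f(x\<^sub>i)\<close> and derivatives \<open>g\<^sub>i\<close> at increasing points \<open>x\<^sub>i\<close> are
  attained by such a function as soon as consecutive points are compatible (\<open>chain_interpolation\<close>).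
  Let \<open>d\<^sub>i\<close> be the length of the \<open>i\<close>-th interval, \<open>s\<^sub>i\<close> the slope of the data on it, and
  \<open>u\<^sub>i = s\<^sub>i - g\<^sub>i\<close>, \<open>v\<^sub>i = g\<^sub>i\<^sub>+\<^sub>1 - s\<^sub>i\<close> the deviations at its ends. Compatibility means
  \<open>(u\<^sub>i + v\<^sub>i)\<^sup>2 \<le> 2 K d\<^sub>i min(u\<^sub>i, v\<^sub>i)\<close>: neither deviation may be much smaller than the other. The
  choice of \<open>g\<^sub>i\<close> amounts to splitting the jump \<open>w\<^sub>i = s\<^sub>i - s\<^sub>i\<^sub>-\<^sub>1\<close> into \<open>v\<^sub>i\<^sub>-\<^sub>1 + u\<^sub>i\<close>.

  For \<open>K = M\<close> the splits at different points depend on each other along the whole chain. The factor 2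
  cuts this dependence. Since \<open>u\<^sub>i \<le> w\<^sub>i\<close>, compatibility for \<open>M\<close> bounds \<open>v\<^sub>i\<close> by a capacity that depends on
  \<open>d\<^sub>i\<close> and \<open>w\<^sub>i\<close> only, and likewise \<open>u\<^sub>i\<close> by one that depends on \<open>d\<^sub>i\<close> and \<open>w\<^sub>i\<^sub>+\<^sub>1\<close>. Applied to
  \<open>x\<^sub>i\<^sub>-\<^sub>2, \<dots>, x\<^sub>i\<^sub>+\<^sub>2\<close>, the hypothesis says that \<open>w\<^sub>i\<close> is at most the sum of the capacities of its two
  parts. So each jump can be split under these caps, and it is split as evenly as they permit. Then on
  each interval either \<open>u\<^sub>i \<ge> w\<^sub>i / 2\<close>, and the halving is paid for by the doubled constant, or \<open>u\<^sub>i\<close> is at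
  its capacity and not smaller than \<open>v\<^sub>i\<close>; the same holds with \<open>u\<close> and \<open>v\<close> exchanged. This is
  compatibility for \<open>2 M\<close> (\<open>doubled_compatibility\<close>, \<open>chain_gradients\<close>).

  This settles finite subsets of \<open>E\<close>. Having curvature between \<open>0\<close> and \<open>2 M\<close> is closed under pointwise
  limits (\<open>curvature_within_iff_convex\<close>), and two prescribed values confine such a function to a compact
  product of intervals, so Tychonoff's theorem passes from finite subsets to \<open>E\<close>
  (\<open>extension_by_compactness\<close>).
\<close>

section \<open>Functions with bounded curvature\<close>

text \<open>
  In terms of second derivatives: \<open>0 \<le> F'' \<le> K\<close>, phrased for the derivative \<open>h\<close> because \<open>h\<close> need
  not be differentiable.
\<close>

definition curvature_within :: "real \<Rightarrow> (real \<Rightarrow> real) \<Rightarrow> (real \<Rightarrow> real) \<Rightarrow> bool" where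
  "curvature_within K F h \<longleftrightarrow> (\<forall>t. (F has_real_derivative h t) (at t)) \<and>
     (\<forall>s t. s \<le> t \<longrightarrow> h s \<le> h t \<and> h t - h s \<le> K * (t - s))"

lemma curvature_withinD:
  assumes "curvature_within K F h"
  shows "(F has_real_derivative h t) (at t)"
    and "s \<le> t \<Longrightarrow> h s \<le> h t"
    and "s \<le> t \<Longrightarrow> h t - h s \<le> K * (t - s)"
  using assms by (auto simp: curvature_within_def)

lemma curvature_within_iff_C11c:
  assumes "K \<ge> 0"
  shows "(\<exists>h. curvature_within K F h) \<longleftrightarrow> F \<in> C11c \<and> Lip (deriv F) \<le> ereal K"
proof
  assume "\<exists>h. curvature_within K F h"
  then obtain h where h: "curvature_within K F h" by blast
  note hD = curvature_withinD[OF h]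
  have dF: "deriv F = h"
    using hD(1) DERIV_imp_deriv by blast
  have abs_le: "\<bar>h x - h y\<bar> \<le> K * \<bar>x - y\<bar>" for x y
    using hD(2,3)[of x y] hD(2,3)[of y x] by (cases "x \<le> y") auto
  have "convex_on UNIV F"
    by (rule convex_on_realI[of _ _ h]) (use hD in auto)
  moreover have "F differentiable_on UNIV"
    using hD(1) by (meson differentiable_on_def differentiable_at_withinI real_differentiable_def)
  moreover have "K-lipschitz_on UNIV (deriv F)"
    unfolding dF by (rule lipschitz_onI) (use abs_le assms in \<open>auto simp: dist_real_def\<close>)
  moreover have "Lip (deriv F) \<le> ereal K"
    unfolding dF Lip_def by (rule SUP_least) (use abs_le in \<open>auto simp: divide_simps\<close>)
  ultimately show "F \<in> C11c \<and> Lip (deriv F) \<le> ereal K"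
    by (auto simp: C11c_def)
next
  assume F: "F \<in> C11c \<and> Lip (deriv F) \<le> ereal K"
  have der: "(F has_real_derivative deriv F t) (at t)" for t
    using F DERIV_deriv_iff_real_differentiable
    by (auto simp: C11c_def differentiable_on_def)
  have lip: "\<bar>deriv F t - deriv F s\<bar> \<le> K * \<bar>t - s\<bar>" for s t
  proof (cases "t = s")
    case False
    have "ereal (\<bar>deriv F t - deriv F s\<bar> / \<bar>t - s\<bar>) \<le> Lip (deriv F)"
      unfolding Lip_def using False by (intro SUP_upper2[of "(t, s)"]) auto
    then show ?thesis using F False
      by (metis (no_types, lifting) ereal_less_eq(3) mult.commute order_trans pos_divide_le_eq
          right_minus_eq zero_less_abs_iff)
  qed simp
  have tangent: "F y - F x \<ge> deriv F x * (y - x)" for x y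
    by (rule convex_on_imp_above_tangent[of UNIV]) (use F der in \<open>auto simp: C11c_def\<close>)
  have mono: "deriv F s \<le> deriv F t" if "s \<le> t" for s t
  proof (cases "s = t")
    case False
    have "0 \<le> (deriv F t - deriv F s) * (t - s)"
      using tangent[of s t] tangent[of t s] by (simp add: algebra_simps)
    then show ?thesis using that False by (simp add: zero_le_mult_iff)
  qed simp
  have "curvature_within K F (deriv F)"
    unfolding curvature_within_def
  proof (intro conjI allI impI)
    fix s t :: real assume "s \<le> t"
    then show "deriv F s \<le> deriv F t" "deriv F t - deriv F s \<le> K * (t - s)"
      using mono[of s t] lip[of t s] by (auto simp: abs_if)
  qed (rule der)
  then show "\<exists>h. curvature_within K F h" by blast
qed

text \<open>
  The right-hand side no longer mentions a derivative, and it consists of inequalities between values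
  of \<open>F\<close>; it therefore survives pointwise limits, which is what the compactness argument uses. From
  right to left, a supporting line of \<open>F\<close> and one of the second function squeeze \<open>F\<close> between its
  tangent line and that line plus \<open>K / 2 * (y - x)\<^sup>2\<close>.
\<close>

lemma curvature_within_iff_convex:
  "(\<exists>h. curvature_within K F h) \<longleftrightarrow>
     convex_on UNIV F \<and> convex_on UNIV (\<lambda>t. K / 2 * t\<^sup>2 - F t)"
proof
  assume "\<exists>h. curvature_within K F h"
  then obtain h where h: "curvature_within K F h" by blast
  note hD = curvature_withinD[OF h]
  have "convex_on UNIV F"
    by (rule convex_on_realI[of _ _ h]) (use hD in auto)
  moreover have "convex_on UNIV (\<lambda>t. K / 2 * t\<^sup>2 - F t)"
  proof (rule convex_on_realI[of _ _ "\<lambda>t. K * t - h t"])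
    fix t show "((\<lambda>t. K / 2 * t\<^sup>2 - F t) has_real_derivative K * t - h t) (at t)"
      by (auto intro!: derivative_eq_intros hD(1))
  qed (use hD(3) in \<open>auto simp: algebra_simps\<close>)
  ultimately show "convex_on UNIV F \<and> convex_on UNIV (\<lambda>t. K / 2 * t\<^sup>2 - F t)" by blast
next
  let ?G = "\<lambda>t. K / 2 * t\<^sup>2 - F t"
  assume cvx: "convex_on UNIV F \<and> convex_on UNIV ?G"
  have "\<exists>p. \<forall>y. 0 \<le> F y - F x - p * (y - x) \<and> F y - F x - p * (y - x) \<le> K / 2 * (y - x)\<^sup>2" for x
  proof -
    obtain p where p: "\<And>y. F y \<ge> F x + p * (y - x)"
      using convex_le_Inf_differential[of UNIV F x] cvx by fastforce
    obtain q where q: "\<And>y. ?G y \<ge> ?G x + q * (y - x)"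
      using convex_le_Inf_differential[of UNIV ?G x] cvx by fastforce
    have up: "F y - F x \<le> (K * x - q) * (y - x) + K / 2 * (y - x)\<^sup>2" for y
      using q[of y] by (simp add: power2_eq_square field_simps)
    \<comment> \<open>The sum of the two supporting lines supports the parabola, so it is its tangent.\<close>
    have "p + q = K * x"
    proof -
      let ?e = "p + q - K * x"
      have le: "?e * d \<le> K / 2 * d\<^sup>2" for d
        using p[of "x + d"] up[of "x + d"] by (simp add: algebra_simps)
      have "(\<lambda>d. K / 2 * d) \<midarrow>0\<rightarrow> K / 2 * 0" by (intro tendsto_intros)
      then have r: "((\<lambda>d. K / 2 * d) \<longlongrightarrow> 0) (at_right 0)" and l: "((\<lambda>d. K / 2 * d) \<longlongrightarrow> 0) (at_left 0)"
        by (auto simp: filterlim_at_split)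
      have "?e \<le> 0"
      proof (rule tendsto_lowerbound[OF r])
        show "\<forall>\<^sub>F d in at_right 0. ?e \<le> K / 2 * d"
          using eventually_at_right_less[of "0::real"]
        proof eventually_elim
          case (elim d)
          have "?e * d \<le> (K / 2 * d) * d" using le[of d] by (simp add: power2_eq_square)
          then show ?case using elim by (simp only: mult_le_cancel_right_pos)
        qed
      qed simp
      moreover have "?e \<ge> 0"
      proof (rule tendsto_upperbound[OF l])
        show "\<forall>\<^sub>F d in at_left 0. ?e \<ge> K / 2 * d"
          unfolding eventually_at_left_field
        proof (intro exI[of _ "-1"] conjI allI impI)
          fix d :: real assume "- 1 < d" "d < 0"
          have "?e * d \<le> (K / 2 * d) * d" using le[of d] by (simp add: power2_eq_square)
          then show "?e \<ge> K / 2 * d" using \<open>d < 0\<close> by (simp only: mult_le_cancel_right_neg)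
        qed simp
      qed simp
      ultimately show ?thesis by linarith
    qed
    then have "K * x - q = p" by simp
    then have "F y - F x - p * (y - x) \<le> K / 2 * (y - x)\<^sup>2" for y
      using up[of y] by simp
    then show ?thesis using p by (intro exI[of _ p]) (simp add: algebra_simps)
  qed
  then obtain h where lower: "\<And>x y. 0 \<le> F y - F x - h x * (y - x)"
    and upper: "\<And>x y. F y - F x - h x * (y - x) \<le> K / 2 * (y - x)\<^sup>2"
    by metis
  have der: "(F has_real_derivative h x) (at x)" for x
  proof -
    have "((\<lambda>y. (F y - F x) / (y - x) - h x) \<longlongrightarrow> 0) (at x)"
    proof (rule Lim_null_comparison)
      show "\<forall>\<^sub>F y in at x. norm ((F y - F x) / (y - x) - h x) \<le> \<bar>K / 2\<bar> * \<bar>y - x\<bar>"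
        unfolding eventually_at_filter
      proof (intro always_eventually allI impI)
        fix y assume "y \<noteq> x"
        have "\<bar>F y - F x - h x * (y - x)\<bar> \<le> K / 2 * (y - x)\<^sup>2"
          using lower[of y x] upper[of y x] by simp
        also have "\<dots> \<le> \<bar>K / 2\<bar> * (y - x)\<^sup>2" by (intro mult_right_mono) auto
        also have "\<dots> = \<bar>K / 2\<bar> * \<bar>y - x\<bar> * \<bar>y - x\<bar>"
          by (simp add: power2_eq_square mult.assoc)
        finally have "\<bar>F y - F x - h x * (y - x)\<bar> \<le> \<bar>K / 2\<bar> * \<bar>y - x\<bar> * \<bar>y - x\<bar>" .
        moreover have "(F y - F x) / (y - x) - h x = (F y - F x - h x * (y - x)) / (y - x)"
          using \<open>y \<noteq> x\<close> by (simp add: field_simps)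
        ultimately show "norm ((F y - F x) / (y - x) - h x) \<le> \<bar>K / 2\<bar> * \<bar>y - x\<bar>"
          using \<open>y \<noteq> x\<close> by (simp add: abs_divide pos_divide_le_eq del: abs_mult_self_eq)
      qed
      have "((\<lambda>y. \<bar>K / 2\<bar> * \<bar>y - x\<bar>) \<longlongrightarrow> \<bar>K / 2\<bar> * \<bar>x - x\<bar>) (at x)" by (intro tendsto_intros)
      then show "((\<lambda>y. \<bar>K / 2\<bar> * \<bar>y - x\<bar>) \<longlongrightarrow> 0) (at x)" by simp
    qed
    then show ?thesis
      unfolding has_field_derivative_iff by (rule LIM_zero_cancel)
  qed
  have G_der: "(?G has_real_derivative K * t - h t) (at t)" for t
    by (auto intro!: derivative_eq_intros der)
  have "h s \<le> h t \<and> h t - h s \<le> K * (t - s)" if "s \<le> t" for s t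
  proof (cases "s = t")
    case False
    have G: "?G y - ?G x \<ge> (K * x - h x) * (y - x)" for x y
      by (rule convex_on_imp_above_tangent[of UNIV]) (use cvx G_der in auto)
    have "0 \<le> (h t - h s) * (t - s)"
      using lower[of t s] lower[of s t] by (simp add: algebra_simps)
    moreover have "0 \<le> (K * (t - s) - (h t - h s)) * (t - s)"
      using G[of s t] G[of t s] by (simp add: algebra_simps)
    ultimately show ?thesis using that False by (simp add: zero_le_mult_iff)
  qed simp
  with der show "\<exists>h. curvature_within K F h" unfolding curvature_within_def by blast
qed

text \<open>
  The tangent at \<open>x\<close> lies below \<open>F\<close>, and the tangent parabola of curvature \<open>K\<close> at \<open>y\<close> lies above it;
  the inequality compares the two where they are closest, at the minimum of their difference.
\<close>

lemma convex_cocoercive: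
  assumes F: "curvature_within K F h" and "K > 0"
  shows "(h y - h x)\<^sup>2 \<le> 2 * K * (F y - F x - h x * (y - x))"
proof -
  have "convex_on UNIV F" "convex_on UNIV (\<lambda>t. K / 2 * t\<^sup>2 - F t)" (is "convex_on UNIV ?G")
    using F curvature_within_iff_convex by blast+
  note dF = curvature_withinD(1)[OF F]
  have dG: "(?G has_real_derivative K * t - h t) (at t)" for t
    by (auto intro!: derivative_eq_intros dF)
  \<comment> \<open>The minimiser of the difference between the parabola at \<open>y\<close> and the tangent at \<open>x\<close>.\<close>
  define z where "z = y - (h y - h x) / K"
  have hK: "h y = h x + K * (y - z)" using \<open>K > 0\<close> by (simp add: z_def)
  have 1: "F z - F x \<ge> h x * (z - x)"
    by (rule convex_on_imp_above_tangent[of UNIV]) (use \<open>convex_on UNIV F\<close> dF in auto)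
  have 2: "?G z - ?G y \<ge> (K * y - h y) * (z - y)"
    by (rule convex_on_imp_above_tangent[of UNIV]) (use \<open>convex_on UNIV ?G\<close> dG in auto)
  have "K / 2 * (y - z)\<^sup>2 \<le> F y - F x - h x * (y - x)"
    using 1 2 unfolding hK by (simp add: power2_eq_square field_simps)
  then have "2 * K * (K / 2 * (y - z)\<^sup>2) \<le> 2 * K * (F y - F x - h x * (y - x))"
    using \<open>K > 0\<close> by (intro mult_left_mono) auto
  then show ?thesis unfolding hK by (simp add: power2_eq_square algebra_simps)
qed

section \<open>Capacities\<close>

text \<open>
  Let \<open>u\<close> and \<open>v\<close> be the deviations of the end derivatives from the mean slope on an interval of length
  \<open>d\<close>, and let \<open>m = M * d\<close>. Then \<open>(u + v)\<^sup>2 \<le> 2 * m * u\<close> and \<open>(u + v)\<^sup>2 \<le> 2 * m * v\<close>. The capacity is the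
  largest \<open>v\<close> that these inequalities allow for some \<open>u \<le> w\<close>. The boundary curve
  \<open>v = sqrt (2 * m * u) - u\<close> increases up to \<open>u = m / 2\<close>, the largest possible deviation, hence the
  minimum with \<open>m / 2\<close>.
\<close>

definition capacity :: "real \<Rightarrow> real \<Rightarrow> real" where
  "capacity m w = sqrt (2 * m * min w (m / 2)) - min w (m / 2)"

lemma sqrt_minus_self_mono:
  assumes "0 \<le> a" "a \<le> b" "b \<le> m / 2"
  shows "sqrt (2 * m * a) - a \<le> sqrt (2 * m * b) - b"
proof (cases "m = 0")
  case False
  then have "m > 0" using assms by linarith
  define A B where "A = sqrt (2 * m * a)" and "B = sqrt (2 * m * b)"
  have sq: "A\<^sup>2 = 2 * m * a" "B\<^sup>2 = 2 * m * b"
    using assms \<open>m > 0\<close> by (auto simp: A_def B_def)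
  have "A \<le> B" unfolding A_def B_def using assms \<open>m > 0\<close> by auto
  moreover have "B \<le> m"
    unfolding B_def by (rule real_le_lsqrt) (use assms \<open>m > 0\<close> in \<open>auto simp: power2_eq_square\<close>)
  ultimately have "(B - A) * (A + B) \<le> (B - A) * (2 * m)" by (intro mult_left_mono) auto
  then have "2 * m * (b - a) \<le> 2 * m * (B - A)"
    using sq by (simp add: power2_eq_square algebra_simps)
  then show ?thesis using \<open>m > 0\<close> by (simp add: A_def B_def)
qed (use assms in auto)

lemma capacity_ge_min:
  assumes "0 \<le> w" "0 \<le> m"
  shows "min w (m / 2) \<le> capacity m w"
proof -
  have "2 * min w (m / 2) \<le> sqrt (2 * m * min w (m / 2))"
  proof (rule real_le_rsqrt)
    have "min w (m / 2) * (2 * min w (m / 2)) \<le> min w (m / 2) * m"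
      using assms by (intro mult_left_mono) auto
    then show "(2 * min w (m / 2))\<^sup>2 \<le> 2 * m * min w (m / 2)"
      by (simp add: power2_eq_square algebra_simps)
  qed
  then show ?thesis by (simp add: capacity_def)
qed

lemma capacity_nonneg: "0 \<le> w \<Longrightarrow> 0 \<le> m \<Longrightarrow> 0 \<le> capacity m w"
  using capacity_ge_min[of w m] by (auto simp: min_def split: if_splits)

lemma capacity_le_half:
  assumes "0 \<le> w" "0 \<le> m"
  shows "capacity m w \<le> m / 2"
  using sqrt_minus_self_mono[of "min w (m / 2)" "m / 2" m] assms
  by (simp add: capacity_def flip: power2_eq_square)

lemma excess_le_capacity:
  assumes "m > 0" and u: "(u + v)\<^sup>2 \<le> 2 * m * u" and v: "(u + v)\<^sup>2 \<le> 2 * m * v" and "u \<le> w"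
  shows "v \<le> capacity m w"
proof -
  have pos: "0 \<le> 2 * m * u" "0 \<le> 2 * m * v" using u v zero_le_power2[of "u + v"] by linarith+
  then have "0 \<le> u" "0 \<le> v" using \<open>m > 0\<close> by (auto simp: zero_le_mult_iff)
  \<comment> \<open>Adding the two hypotheses gives \<open>(u + v)\<^sup>2 \<le> m * (u + v)\<close>.\<close>
  have "u + v \<le> m"
  proof (rule ccontr)
    assume "\<not> u + v \<le> m"
    then have "m * (u + v) < (u + v) * (u + v)" using \<open>m > 0\<close> by (intro mult_strict_right_mono) auto
    then show False using u v by (simp add: power2_eq_square algebra_simps)
  qed
  have half: "u \<le> m / 2"
  proof -
    have "u + v \<le> sqrt (2 * m * v)" using v pos by (intro real_le_rsqrt) auto
    moreover have "\<dots> \<le> m / 2 + v"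
      by (rule real_le_lsqrt) (use \<open>m > 0\<close> \<open>0 \<le> v\<close> zero_le_power2[of "m / 2 - v"] in
          \<open>auto simp: power2_eq_square algebra_simps\<close>)
    ultimately show ?thesis by linarith
  qed
  have "u + v \<le> sqrt (2 * m * u)" using u pos by (intro real_le_rsqrt) auto
  moreover have "sqrt (2 * m * u) - u \<le> capacity m w"
    unfolding capacity_def by (rule sqrt_minus_self_mono) (use \<open>0 \<le> u\<close> half \<open>u \<le> w\<close> in auto)
  ultimately show ?thesis by linarith
qed

text \<open>
  This is where the factor 2 enters. If \<open>u\<close> is at least half of the amount \<open>w1\<close> for which the capacity
  of \<open>v\<close> was computed, then doubling \<open>m\<close> makes up for the halving, because only the product \<open>m * u\<close>
  stands under the square root. Otherwise \<open>u\<close> is at its capacity, hence at least as large as \<open>v\<close>, and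
  the inequality follows from \<open>u \<le> m\<close>. Exchanging the two ends of the interval gives the same bound with
  \<open>v\<close> in place of the last \<open>u\<close>, the other half of the compatibility condition.
\<close>

lemma doubled_compatibility:
  assumes "m > 0" "0 \<le> w1" "0 \<le> w2"
    and u: "0 \<le> u" "u \<le> capacity m w2" "u \<ge> w1 / 2 \<or> u = capacity m w2"
    and v: "0 \<le> v" "v \<le> capacity m w1" "v \<le> w2"
  shows "(u + v)\<^sup>2 \<le> 2 * (2 * m) * u"
  using u(3)
proof
  assume "u \<ge> w1 / 2"
  define w where "w = min w1 (m / 2)"
  have "u \<le> m / 2" using u(2) capacity_le_half[of w2 m] assms by linarith
  then have "sqrt (2 * (2 * m) * (w / 2)) - w / 2 \<le> sqrt (2 * (2 * m) * u) - u"
    using assms \<open>u \<ge> w1 / 2\<close> by (intro sqrt_minus_self_mono) (auto simp: w_def)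
  moreover have "v \<le> sqrt (2 * m * w) - w"
    using v(2) by (simp add: capacity_def w_def)
  moreover have "0 \<le> w" using assms by (simp add: w_def)
  ultimately have "u + v \<le> sqrt (2 * (2 * m) * u)" by (simp add: mult.assoc)
  then have "(u + v)\<^sup>2 \<le> (sqrt (2 * (2 * m) * u))\<^sup>2" using u(1) v(1) by (intro power_mono) auto
  then show ?thesis using u(1) \<open>m > 0\<close> by simp
next
  assume "u = capacity m w2"
  then have "v \<le> u" "u \<le> m / 2"
    using capacity_ge_min[of w2 m] capacity_le_half[of w2 m] capacity_le_half[of w1 m] v assms
    by (auto simp: min_def split: if_splits)
  then have "(u + v)\<^sup>2 \<le> (2 * u)\<^sup>2" using u(1) v(1) by (intro power_mono) auto
  also have "\<dots> = 4 * u * u" by (simp add: power2_eq_square)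
  also have "\<dots> \<le> 4 * m * u" using \<open>u \<le> m / 2\<close> u(1) \<open>m > 0\<close> by (intro mult_right_mono) auto
  finally show ?thesis by simp
qed

text \<open>
  The division of \<open>w\<close> into \<open>v\<close> and \<open>w - v\<close> that is closest to even under the caps \<open>a\<close> and \<open>b\<close>: a part
  below \<open>w / 2\<close> is stopped by its own cap.
\<close>

lemma balanced_split:
  fixes w :: real
  assumes "0 \<le> w" "0 \<le> a" "0 \<le> b" "w \<le> a + b"
  obtains v where "0 \<le> v" "v \<le> a" "v \<ge> w / 2 \<or> v = a"
    and "v \<le> w" "w - v \<le> b" "w - v \<ge> w / 2 \<or> w - v = b"
  using assms by (intro that[of "min a (max (w / 2) (w - b))"]) (auto simp: min_def max_def field_simps)

section \<open>Derivatives along a finite chain of points\<close>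

definition slope :: "(real \<Rightarrow> real) \<Rightarrow> real \<Rightarrow> real \<Rightarrow> real" where
  "slope F a b = (F b - F a) / (b - a)"

lemma slope_deviations:
  assumes F: "curvature_within M F h" and "M > 0" "a < b"
  shows "((slope F a b - h a) + (h b - slope F a b))\<^sup>2 \<le> 2 * (M * (b - a)) * (slope F a b - h a)"
    and "((slope F a b - h a) + (h b - slope F a b))\<^sup>2 \<le> 2 * (M * (b - a)) * (h b - slope F a b)"
    and "h a \<le> slope F a b" "slope F a b \<le> h b"
proof -
  have s: "F b - F a = slope F a b * (b - a)" using \<open>a < b\<close> by (simp add: slope_def)
  have eq: "F b - F a - h a * (b - a) = (b - a) * (slope F a b - h a)"
    "F a - F b - h b * (a - b) = (b - a) * (h b - slope F a b)"
    using s by (auto simp: algebra_simps)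
  show 1: "((slope F a b - h a) + (h b - slope F a b))\<^sup>2 \<le> 2 * (M * (b - a)) * (slope F a b - h a)"
    using convex_cocoercive[OF F \<open>M > 0\<close>, of b a] unfolding eq by (simp add: mult.assoc)
  show 2: "((slope F a b - h a) + (h b - slope F a b))\<^sup>2 \<le> 2 * (M * (b - a)) * (h b - slope F a b)"
    using convex_cocoercive[OF F \<open>M > 0\<close>, of a b] unfolding eq
    by (simp add: mult.assoc power2_commute)
  have "0 < 2 * (M * (b - a))" using \<open>M > 0\<close> \<open>a < b\<close> by simp
  then show "h a \<le> slope F a b" "slope F a b \<le> h b"
    using 1 2 by (smt (verit) zero_le_power2 zero_le_mult_iff)+
qed

text \<open>
  A neighbour \<open>a\<close> on the left bounds \<open>h b\<close> from below by the slope on \<open>[a, b]\<close>, so the left deviation on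
  \<open>[b, c]\<close> is at most the jump of slopes at \<open>b\<close>. The first alternative for \<open>w\<close> covers a leftmost point
  \<open>b\<close>, where only the trivial bound \<open>M * (c - b)\<close> on the deviation is available.
\<close>

lemma right_deviation_le:
  assumes F: "curvature_within M F h" and "M > 0" "b < c"
    and w: "w \<ge> M * (c - b) \<or> (\<exists>a<b. w = slope F b c - slope F a b)"
  shows "h c - slope F b c \<le> capacity (M * (c - b)) w"
proof (rule excess_le_capacity)
  note dev = slope_deviations[OF F \<open>M > 0\<close> \<open>b < c\<close>]
  show "0 < M * (c - b)" using assms by simp
  show "slope F b c - h b \<le> w"
    using w
  proof
    assume "w \<ge> M * (c - b)"
    moreover have "h c - h b \<le> M * (c - b)" using curvature_withinD(3)[OF F] \<open>b < c\<close> by auto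
    ultimately show ?thesis using dev(4) by linarith
  next
    assume "\<exists>a<b. w = slope F b c - slope F a b"
    then show ?thesis using slope_deviations(4)[OF F \<open>M > 0\<close>] by fastforce
  qed
qed (use slope_deviations[OF F \<open>M > 0\<close> \<open>b < c\<close>] in blast)+

lemma left_deviation_le:
  assumes F: "curvature_within M F h" and "M > 0" "a < b"
    and w: "w \<ge> M * (b - a) \<or> (\<exists>c>b. w = slope F b c - slope F a b)"
  shows "slope F a b - h a \<le> capacity (M * (b - a)) w"
proof (rule excess_le_capacity)
  note dev = slope_deviations[OF F \<open>M > 0\<close> \<open>a < b\<close>]
  show "0 < M * (b - a)" using assms by simp
  show "h b - slope F a b \<le> w"
    using w
  proof
    assume "w \<ge> M * (b - a)"
    moreover have "h b - h a \<le> M * (b - a)" using curvature_withinD(3)[OF F] \<open>a < b\<close> by auto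
    ultimately show ?thesis using dev(3) by linarith
  next
    assume "\<exists>c>b. w = slope F b c - slope F a b"
    then show ?thesis using slope_deviations(3)[OF F \<open>M > 0\<close>] by fastforce
  qed
  show "(h b - slope F a b + (slope F a b - h a))\<^sup>2 \<le> 2 * (M * (b - a)) * (h b - slope F a b)"
    "(h b - slope F a b + (slope F a b - h a))\<^sup>2 \<le> 2 * (M * (b - a)) * (slope F a b - h a)"
    using dev(1,2) by (simp_all add: add.commute)
qed

text \<open>
  At an inner point \<open>x i\<close> the jump \<open>w i\<close> of the slopes is the sum of the right deviation of the interval
  before \<open>x i\<close> and the left deviation of the interval after it. A function through the five points
  \<open>x (i - 2), \<dots>, x (i + 2)\<close>, or as many of them as exist, shows that \<open>w i\<close> is at most the
  sum of the two capacities, which depend only on these points. So the jump can be split under both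
  caps, independently at each point, and the most even such split satisfies the compatibility conditions for \<open>2 * M\<close> on every interval.
\<close>

lemma chain_gradients:
  fixes x :: "nat \<Rightarrow> real" and f :: "real \<Rightarrow> real"
  assumes "M > 0" "n > 0" and x: "strict_mono_on {..n} x"
    and five: "\<And>I. I \<subseteq> {..n} \<Longrightarrow> card I \<le> 5 \<Longrightarrow>
        \<exists>F h. curvature_within M F h \<and> (\<forall>i\<in>I. F (x i) = f (x i))"
  obtains g :: "nat \<Rightarrow> real" where
    "\<And>i. i < n \<Longrightarrow> (g (Suc i) - g i)\<^sup>2 \<le>
        2 * (2 * M) * (f (x (Suc i)) - f (x i) - g i * (x (Suc i) - x i))"
    "\<And>i. i < n \<Longrightarrow> (g (Suc i) - g i)\<^sup>2 \<le>
        2 * (2 * M) * (f (x i) - f (x (Suc i)) - g (Suc i) * (x i - x (Suc i)))"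
proof -
  define d where "d i = x (Suc i) - x i" for i
  define s where "s i = slope f (x i) (x (Suc i))" for i
  \<comment> \<open>At the two ends there is no jump; the values chosen there are at least half of \<open>M * d\<close>, so that
    the capacities computed from them are the largest possible ones.\<close>
  define w where "w i = (if i = 0 then M * d 0 else if i = n then M * d (n - 1) else s i - s (i - 1))" for i
  have xl: "x i < x j" if "i < j" "j \<le> n" for i j
    using strict_mono_onD[OF x] that by auto
  have d_pos: "M * d i > 0" if "i < n" for i
    using xl[of i "Suc i"] that \<open>M > 0\<close> by (simp add: d_def)
  have w_pos: "w i \<ge> 0 \<and> (0 < i \<longrightarrow> i < n \<longrightarrow>
      w i \<le> capacity (M * d (i - 1)) (w (i - 1)) + capacity (M * d i) (w (Suc i)))" if "i \<le> n" for i
  proof (cases "0 < i \<and> i < n")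
    case True
    define I where "I = {i - 2..i + 2} \<inter> {..n}"
    have "card I \<le> card {i - 2..i + 2}" unfolding I_def by (intro card_mono) auto
    then have "card I \<le> 5" by simp
    moreover have "I \<subseteq> {..n}" by (auto simp: I_def)
    ultimately obtain F h where F: "curvature_within M F h" and "\<forall>i\<in>I. F (x i) = f (x i)"
      using five by blast
    then have s_eq: "slope F (x j) (x (Suc j)) = s j" if "j < n" "i - 2 \<le> j" "j \<le> i + 1" for j
      using that by (auto simp: s_def slope_def I_def)
    have prev: "Suc (i - 1) = i" and "i - 1 < n" "i - 2 \<le> i - 1" "i - 1 \<le> i + 1"
      using True by arith+
    with s_eq[of "i - 1"] have s_prev: "slope F (x (i - 1)) (x i) = s (i - 1)" by simp
    have "s (i - 1) \<le> h (x i)"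
      using slope_deviations(4)[OF F \<open>M > 0\<close> xl[of "i - 1" i]] s_prev True by simp
    moreover have "h (x i) \<le> s i"
      using slope_deviations(3)[OF F \<open>M > 0\<close> xl[of i "Suc i"]] s_eq[of i] True by simp
    moreover have "h (x i) - slope F (x (i - 1)) (x i) \<le> capacity (M * (x i - x (i - 1))) (w (i - 1))"
    proof (rule right_deviation_le[OF F \<open>M > 0\<close>])
      show "x (i - 1) < x i" using True by (intro xl) auto
      show "M * (x i - x (i - 1)) \<le> w (i - 1) \<or>
        (\<exists>a<x (i - 1). w (i - 1) = slope F (x (i - 1)) (x i) - slope F a (x (i - 1)))"
      proof (cases "i = 1")
        case False
        have prev2: "Suc (i - 2) = i - 1" and "i - 2 < n" "i - 2 \<le> i + 1"
          using True False by arith+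
        with s_eq[of "i - 2"] have "slope F (x (i - 2)) (x (i - 1)) = s (i - 2)" by simp
        moreover have "w (i - 1) = s (i - 1) - s (i - 2)"
          using True False by (auto simp: w_def numeral_2_eq_2)
        ultimately have "w (i - 1) = slope F (x (i - 1)) (x i) - slope F (x (i - 2)) (x (i - 1))"
          using s_prev by simp
        moreover have "x (i - 2) < x (i - 1)" using True False by (intro xl) auto
        ultimately show ?thesis by blast
      qed (simp add: w_def d_def)
    qed
    moreover have "slope F (x i) (x (Suc i)) - h (x i) \<le> capacity (M * (x (Suc i) - x i)) (w (Suc i))"
    proof (rule left_deviation_le[OF F \<open>M > 0\<close>])
      show "x i < x (Suc i)" using True by (intro xl) auto
      show "M * (x (Suc i) - x i) \<le> w (Suc i) \<or>
        (\<exists>c>x (Suc i). w (Suc i) = slope F (x (Suc i)) c - slope F (x i) (x (Suc i)))"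
      proof (cases "Suc i = n")
        case True
        then show ?thesis by (auto simp: w_def d_def)
      next
        case False
        then have "w (Suc i) = slope F (x (Suc i)) (x (Suc (Suc i))) - slope F (x i) (x (Suc i))"
          using s_eq[of i] s_eq[of "Suc i"] True by (simp add: w_def)
        moreover have "x (Suc i) < x (Suc (Suc i))" using True False by (intro xl) auto
        ultimately show ?thesis by blast
      qed
    qed
    ultimately show ?thesis
      using True s_eq[of i] s_prev prev by (simp add: w_def d_def)
  next
    case False
    then show ?thesis using that d_pos[of 0] d_pos[of "n - 1"] \<open>n > 0\<close> by (auto simp: w_def)
  qed
  let ?a = "\<lambda>i. capacity (M * d (i - 1)) (w (i - 1))"
  let ?b = "\<lambda>i. capacity (M * d i) (w (Suc i))"
  \<comment> \<open>The end points have one deviation each, which is put at its capacity.\<close>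
  have "\<exists>p. (0 < i \<longrightarrow> s (i - 1) \<le> p \<and> p - s (i - 1) \<le> ?a i \<and> p - s (i - 1) \<le> w i \<and>
               (p - s (i - 1) \<ge> w i / 2 \<or> p - s (i - 1) = ?a i)) \<and>
            (i < n \<longrightarrow> p \<le> s i \<and> s i - p \<le> ?b i \<and> s i - p \<le> w i \<and>
               (s i - p \<ge> w i / 2 \<or> s i - p = ?b i))" if "i \<le> n" for i
  proof -
    consider "i = 0" | "i = n" "0 < i" | "0 < i" "i < n" using \<open>i \<le> n\<close> by linarith
    then show ?thesis
    proof cases
      case 1
      then show ?thesis
        using w_pos[of 1] d_pos[of 0] \<open>n > 0\<close> capacity_nonneg[of "w 1" "M * d 0"]
          capacity_le_half[of "w 1" "M * d 0"]
        by (intro exI[of _ "s 0 - ?b 0"]) (auto simp: w_def[of 0])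
    next
      case 2
      then show ?thesis
        using w_pos[of "n - 1"] d_pos[of "n - 1"] capacity_nonneg[of "w (n - 1)" "M * d (n - 1)"]
          capacity_le_half[of "w (n - 1)" "M * d (n - 1)"]
        by (intro exI[of _ "s (n - 1) + ?a n"]) (auto simp: w_def[of n])
    next
      case 3
      have "0 \<le> ?a i" "0 \<le> ?b i"
        using w_pos[of "i - 1"] d_pos[of "i - 1"] w_pos[of "Suc i"] d_pos[of i] 3
        by (simp_all add: capacity_nonneg less_imp_le less_imp_diff_less)
      then obtain v where "0 \<le> v" "v \<le> ?a i" "v \<ge> w i / 2 \<or> v = ?a i"
        and "v \<le> w i" "w i - v \<le> ?b i" "w i - v \<ge> w i / 2 \<or> w i - v = ?b i"
        using balanced_split[of "w i" "?a i" "?b i"] w_pos[of i] 3 by auto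
      moreover have "s (i - 1) + v - s (i - 1) = v" "s i - (s (i - 1) + v) = w i - v"
        using 3 by (simp_all add: w_def)
      ultimately show ?thesis
        by (intro exI[of _ "s (i - 1) + v"]) force
    qed
  qed
  then obtain g where g: "\<And>i. i \<le> n \<Longrightarrow> 0 < i \<Longrightarrow> s (i - 1) \<le> g i \<and> g i - s (i - 1) \<le> ?a i \<and>
        g i - s (i - 1) \<le> w i \<and> (g i - s (i - 1) \<ge> w i / 2 \<or> g i - s (i - 1) = ?a i)"
    "\<And>i. i \<le> n \<Longrightarrow> i < n \<Longrightarrow> g i \<le> s i \<and> s i - g i \<le> ?b i \<and>
        s i - g i \<le> w i \<and> (s i - g i \<ge> w i / 2 \<or> s i - g i = ?b i)"
    by metis
  show ?thesis
  proof
    fix i assume "i < n"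
    have fd: "f (x (Suc i)) - f (x i) = s i * d i"
      using xl[of i "Suc i"] \<open>i < n\<close> by (simp add: s_def d_def slope_def)
    have u: "0 \<le> s i - g i" "s i - g i \<le> capacity (M * d i) (w (Suc i))" "s i - g i \<le> w i"
      "s i - g i \<ge> w i / 2 \<or> s i - g i = capacity (M * d i) (w (Suc i))"
      using g(2)[of i] \<open>i < n\<close> by auto
    have v: "0 \<le> g (Suc i) - s i" "g (Suc i) - s i \<le> capacity (M * d i) (w i)"
      "g (Suc i) - s i \<le> w (Suc i)"
      "g (Suc i) - s i \<ge> w (Suc i) / 2 \<or> g (Suc i) - s i = capacity (M * d i) (w i)"
      using g(1)[of "Suc i"] \<open>i < n\<close> by auto
    have w0: "0 \<le> w i" "0 \<le> w (Suc i)" using w_pos \<open>i < n\<close> by auto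
    have "((s i - g i) + (g (Suc i) - s i))\<^sup>2 \<le> 2 * (2 * (M * d i)) * (s i - g i)"
      using doubled_compatibility[OF d_pos[OF \<open>i < n\<close>] w0 u(1,2,4) v(1-3)] .
    moreover have "s i * d i - g i * d i = d i * (s i - g i)" by (simp add: algebra_simps)
    ultimately show "(g (Suc i) - g i)\<^sup>2 \<le>
        2 * (2 * M) * (f (x (Suc i)) - f (x i) - g i * (x (Suc i) - x i))"
      unfolding fd d_def[symmetric] by (simp add: mult.assoc)
    have "((g (Suc i) - s i) + (s i - g i))\<^sup>2 \<le> 2 * (2 * (M * d i)) * (g (Suc i) - s i)"
      using doubled_compatibility[OF d_pos[OF \<open>i < n\<close>] w0(2,1) v(1,2,4) u(1-3)] .
    moreover have "f (x i) - f (x (Suc i)) - g (Suc i) * (x i - x (Suc i)) = d i * (g (Suc i) - s i)"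
      using fd by (simp add: d_def algebra_simps)
    ultimately show "(g (Suc i) - g i)\<^sup>2 \<le>
        2 * (2 * M) * (f (x i) - f (x (Suc i)) - g (Suc i) * (x i - x (Suc i)))"
      by (simp add: mult.assoc)
  qed
qed

section \<open>Interpolation along a chain\<close>

lemma DERIV_square_max_0:
  "((\<lambda>t::real. (max 0 (t - c))\<^sup>2) has_real_derivative 2 * max 0 (t - c)) (at t)"
proof (cases t c rule: linorder_cases)
  case less
  have "((\<lambda>t. 0) has_real_derivative 2 * max 0 (t - c)) (at t)" using less by simp
  then show ?thesis
    by (rule has_field_derivative_transform_within_open[of _ _ _ "{..<c}"]) (use less in auto)
next
  case equal
  have "(\<lambda>y. max 0 (y - c)) \<midarrow>c\<rightarrow> max 0 (c - c)" by (intro tendsto_intros)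
  moreover have "(\<lambda>y. (max 0 (y - c))\<^sup>2 / (y - c)) = (\<lambda>y. max 0 (y - c))"
    by (auto simp: fun_eq_iff max_def power2_eq_square)
  ultimately show ?thesis using equal by (simp add: has_field_derivative_iff)
next
  case greater
  have "((\<lambda>t. (t - c)\<^sup>2) has_real_derivative 2 * max 0 (t - c)) (at t)"
    using greater by (auto intro!: derivative_eq_intros)
  then show ?thesis
    by (rule has_field_derivative_transform_within_open[of _ _ _ "{c<..}"]) (use greater in auto)
qed

text \<open>
  If \<open>p < q\<close>, the derivative \<open>p\<close> is raised beyond \<open>a\<close> to \<open>q\<close> along a ramp of slope \<open>K\<close>, from \<open>c\<close> to \<open>c + (q - p) / K\<close>.
  Sliding the ramp to the right lowers the value at \<open>b\<close>, so \<open>c\<close> is determined by \<open>z\<close>; the two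
  compatibility inequalities say exactly that the ramp lies within \<open>[a, b]\<close>.
\<close>

lemma bend_affine_end:
  assumes "K > 0" and F: "curvature_within K F h"
    and affine: "\<And>t. t \<ge> a \<Longrightarrow> F t = y + p * (t - a)" and h_end: "\<And>t. t \<ge> a \<Longrightarrow> h t = p"
    and "a < b"
    and left: "(q - p)\<^sup>2 \<le> 2 * K * (z - y - p * (b - a))"
    and right: "(q - p)\<^sup>2 \<le> 2 * K * (y - z - q * (a - b))"
  obtains F' h' where "curvature_within K F' h'" "\<And>t. t \<le> a \<Longrightarrow> F' t = F t"
    "\<And>t. t \<ge> b \<Longrightarrow> F' t = z + q * (t - b)" "\<And>t. t \<ge> b \<Longrightarrow> h' t = q"
proof -
  define u v where "u = z - y - p * (b - a)" and "v = y - z - q * (a - b)"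
  have uv: "u + v = (q - p) * (b - a)" by (simp add: u_def v_def algebra_simps)
  have left': "(q - p)\<^sup>2 \<le> 2 * K * u" and right': "(q - p)\<^sup>2 \<le> 2 * K * v"
    using left right by (simp_all add: u_def v_def)
  have "u \<ge> 0" "v \<ge> 0"
    using left' right' \<open>K > 0\<close> zero_le_power2[of "q - p"]
    by (smt (verit) zero_le_mult_iff)+
  then have "q \<ge> p" using uv \<open>a < b\<close> by (smt (verit) mult_neg_pos)
  show ?thesis
  proof (cases "q = p")
    case True
    then have "u = 0" using uv \<open>u \<ge> 0\<close> \<open>v \<ge> 0\<close> by simp
    then have "z = y + p * (b - a)" by (simp add: u_def)
    then have "F t = z + q * (t - b)" if "t \<ge> b" for t
      using affine[of t] that \<open>a < b\<close> True by (simp add: algebra_simps)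
    then show ?thesis
      using F h_end \<open>a < b\<close> True by (intro that[of F h]) auto
  next
    case False
    define e where "e = q - p"
    have "e > 0" using False \<open>q \<ge> p\<close> by (simp add: e_def)
    define c where "c = b - e / (2 * K) - u / e"
    define c' where "c' = c + e / K"
    have "e / (2 * K) \<le> u / e" "e / (2 * K) \<le> v / e"
      using left' right' \<open>e > 0\<close> \<open>K > 0\<close> by (auto simp: e_def[symmetric] field_simps power2_eq_square)
    moreover have "u / e + v / e = b - a" 
      using uv \<open>e > 0\<close> by (simp add: e_def[symmetric] add_divide_distrib[symmetric])
    moreover have "e / K = 2 * (e / (2 * K))" "0 < e / (2 * K)"
      using \<open>e > 0\<close> \<open>K > 0\<close> by simp_all
    ultimately have cs: "a \<le> c" "c \<le> c'" "c' \<le> b"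
      unfolding c_def c'_def by linarith+
    define r where "r t = max 0 (t - c) - max 0 (t - c')" for t
    define F' where "F' t = F t + K / 2 * ((max 0 (t - c))\<^sup>2 - (max 0 (t - c'))\<^sup>2)" for t
    define h' where "h' t = h t + K * r t" for t
    have "(F' has_real_derivative h' t) (at t)" for t
      unfolding F'_def h'_def r_def
      by (rule derivative_eq_intros DERIV_square_max_0 curvature_withinD(1)[OF F] refl)+
         (simp add: algebra_simps)
    moreover have "h' s \<le> h' t \<and> h' t - h' s \<le> K * (t - s)" if "s \<le> t" for s t
    proof -
      have r: "r s \<le> r t" "r t - r s \<le> t - s" using that cs by (auto simp: r_def max_def)
      have hD: "h s \<le> h t" "h t - h s \<le> K * (t - s)" using curvature_withinD[OF F] that by auto
      have "h' t - h' s = (h t - h s) + K * (r t - r s)" by (simp add: h'_def algebra_simps)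
      moreover have "0 \<le> K * (r t - r s)" using r \<open>K > 0\<close> by simp
      moreover have "(h t - h s) + K * (r t - r s) \<le> K * (t - s)"
      proof -
        \<comment> \<open>The derivatives \<open>h\<close> and \<open>r\<close> increase on opposite sides of \<open>a\<close>, so their growth rates do not add up.\<close>
        consider "t \<le> a" | "a \<le> s" | "s < a" "a < t" by linarith
        then show ?thesis
        proof cases
          case 1
          then have "r t = 0" "r s = 0" using cs that by (auto simp: r_def)
          then show ?thesis using hD by simp
        next
          case 2
          then show ?thesis using h_end that r(2) \<open>K > 0\<close> by simp
        next
          case 3
          have "h t - h s \<le> K * (a - s)" using curvature_withinD(3)[OF F, of s a] h_end 3 by simp
          moreover have "r t - r s \<le> t - a" using 3 cs by (auto simp: r_def max_def)
          then have "K * (r t - r s) \<le> K * (t - a)" using \<open>K > 0\<close> by simp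
          ultimately show ?thesis by (simp add: algebra_simps)
        qed
      qed
      ultimately show ?thesis using hD(1) by linarith
    qed
    ultimately have "curvature_within K F' h'" by (simp add: curvature_within_def)
    then show ?thesis
    proof (rule that)
      fix t assume "t \<le> a"
      then show "F' t = F t" using cs by (simp add: F'_def)
    next
      fix t assume "t \<ge> b"
      have "K / 2 * ((t - c)\<^sup>2 - (t - c')\<^sup>2) = (K * (c' - c)) * (t - (c + c') / 2)"
        by (simp add: power2_eq_square field_simps)
      also have "K * (c' - c) = e" using \<open>K > 0\<close> by (simp add: c'_def)
      also have "(c + c') / 2 = b - u / e" by (simp add: c_def c'_def field_simps)
      also have "e * (t - (b - u / e)) = e * (t - b) + u" using \<open>e > 0\<close> by (simp add: field_simps)
      finally show "F' t = z + q * (t - b)"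
        using \<open>t \<ge> b\<close> cs \<open>a < b\<close> affine[of t] by (simp add: F'_def u_def e_def algebra_simps)
      have "r t = e / K" using \<open>t \<ge> b\<close> cs by (simp add: r_def c'_def)
      then show "h' t = q" using \<open>t \<ge> b\<close> \<open>a < b\<close> h_end \<open>K > 0\<close> by (simp add: h'_def e_def)
    qed
  qed
qed

text \<open>
  It is enough that consecutive points are compatible. The function is kept affine beyond the last
  point, which leaves room for the bend that reaches the next one.
\<close>

lemma chain_interpolation:
  fixes x y g :: "nat \<Rightarrow> real"
  assumes "K > 0" and "strict_mono_on {..n} x"
    and "\<And>i. i < n \<Longrightarrow> (g (Suc i) - g i)\<^sup>2 \<le> 2 * K * (y (Suc i) - y i - g i * (x (Suc i) - x i))"
    and "\<And>i. i < n \<Longrightarrow> (g (Suc i) - g i)\<^sup>2 \<le> 2 * K * (y i - y (Suc i) - g (Suc i) * (x i - x (Suc i)))"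
  shows "\<exists>F h. curvature_within K F h \<and> (\<forall>i\<le>n. F (x i) = y i) \<and>
           (\<forall>t\<ge>x n. F t = y n + g n * (t - x n) \<and> h t = g n)"
  using assms(2-)
proof (induction n)
  case 0
  have "curvature_within K (\<lambda>t. y 0 + g 0 * (t - x 0)) (\<lambda>_. g 0)"
    using \<open>K > 0\<close> by (auto simp: curvature_within_def intro!: derivative_eq_intros)
  then show ?case by (intro exI[of _ "\<lambda>t. y 0 + g 0 * (t - x 0)"] exI[of _ "\<lambda>_. g 0"]) auto
next
  case (Suc n)
  have "strict_mono_on {..n} x" using Suc.prems(1) by (rule monotone_on_subset) auto
  then obtain F h where F: "curvature_within K F h" "\<forall>i\<le>n. F (x i) = y i"
    "\<forall>t\<ge>x n. F t = y n + g n * (t - x n) \<and> h t = g n"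
    using Suc by (metis less_Suc_eq)
  have "x n < x (Suc n)" using strict_mono_onD[OF Suc.prems(1), of n "Suc n"] by simp
  then obtain F' h' where F': "curvature_within K F' h'" "\<And>t. t \<le> x n \<Longrightarrow> F' t = F t"
    "\<And>t. t \<ge> x (Suc n) \<Longrightarrow> F' t = y (Suc n) + g (Suc n) * (t - x (Suc n))"
    "\<And>t. t \<ge> x (Suc n) \<Longrightarrow> h' t = g (Suc n)"
    using bend_affine_end[OF \<open>K > 0\<close> F(1), of "x n" "y n" "g n" "x (Suc n)" "g (Suc n)" "y (Suc n)"]
      F(3) Suc.prems(2,3)[of n] by (metis lessI)
  have "F' (x i) = y i" if "i \<le> Suc n" for i
  proof (cases "i = Suc n")
    case False
    then have "x i \<le> x n"
      using strict_mono_onD[OF Suc.prems(1), of i n] that by (cases "i = n") auto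
    then show ?thesis using F'(2) F(2) False that by simp
  qed (simp add: F'(3))
  then show ?case using F' by blast
qed

lemma finite_extension:
  fixes S :: "real set" and f :: "real \<Rightarrow> real"
  assumes "M > 0" "finite S" "2 \<le> card S"
    and five: "\<And>T. T \<subseteq> S \<Longrightarrow> card T \<le> 5 \<Longrightarrow> \<exists>F h. curvature_within M F h \<and> (\<forall>t\<in>T. F t = f t)"
  obtains F h where "curvature_within (2 * M) F h" "\<And>t. t \<in> S \<Longrightarrow> F t = f t"
proof -
  define n where "n = card S - 1"
  define x where "x i = sorted_list_of_set S ! i" for i
  have n: "0 < n" "card S = Suc n" using assms by (auto simp: n_def)
  have mono: "strict_mono_on {..n} x"
    using sorted_wrt_nth_less[OF strict_sorted_list_of_set[of S]] n
    by (auto simp: x_def strict_mono_on_def)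
  have S: "S = x ` {..n}"
  proof -
    have "x ` {..<Suc n} = set (sorted_list_of_set S)"
      using n by (auto simp: x_def set_conv_nth)
    then show ?thesis using \<open>finite S\<close> by (simp add: lessThan_Suc_atMost)
  qed
  have "\<exists>F h. curvature_within M F h \<and> (\<forall>i\<in>I. F (x i) = f (x i))" if "I \<subseteq> {..n}" "card I \<le> 5" for I
  proof -
    have "finite I" using that finite_subset by blast
    then have "card (x ` I) \<le> 5" using card_image_le[of I x] that by linarith
    then show ?thesis using five[of "x ` I"] that S by blast
  qed
  then obtain g where
    "\<And>i. i < n \<Longrightarrow> (g (Suc i) - g i)\<^sup>2 \<le>
        2 * (2 * M) * (f (x (Suc i)) - f (x i) - g i * (x (Suc i) - x i))"
    "\<And>i. i < n \<Longrightarrow> (g (Suc i) - g i)\<^sup>2 \<le>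
        2 * (2 * M) * (f (x i) - f (x (Suc i)) - g (Suc i) * (x i - x (Suc i)))"
    using chain_gradients[OF \<open>M > 0\<close> \<open>0 < n\<close> mono] by metis
  then obtain F h where "curvature_within (2 * M) F h" "\<forall>i\<le>n. F (x i) = f (x i)"
    using chain_interpolation[of "2 * M" n x g "\<lambda>i. f (x i)"] \<open>M > 0\<close> mono by auto
  then show ?thesis using that S by auto
qed

section \<open>From finite sets to arbitrary sets\<close>

text \<open>
  Somewhere in \<open>[a, b]\<close> the derivative equals the slope between the end points, and it changes at rate at
  most \<open>K\<close>. The bound depends on \<open>F\<close> only through its values at \<open>a\<close> and \<open>b\<close>.
\<close>

lemma curvature_within_bound:
  assumes F: "curvature_within K F h" and "K \<ge> 0" "a < b"
  shows "\<bar>F t - F a\<bar> \<le> (\<bar>slope F a b\<bar> + K * (\<bar>t - a\<bar> + (b - a))) * \<bar>t - a\<bar>"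
proof (cases "t = a")
  case False
  note hD = curvature_withinD[OF F]
  obtain \<xi> where \<xi>: "a < \<xi>" "\<xi> < b" "F b - F a = (b - a) * h \<xi>"
    using MVT2[OF \<open>a < b\<close>, of F h] hD(1) by blast
  then have slope: "h \<xi> = slope F a b" using \<open>a < b\<close> by (simp add: slope_def)
  obtain \<eta> where \<eta>: "\<bar>\<eta> - a\<bar> \<le> \<bar>t - a\<bar>" "F t - F a = (t - a) * h \<eta>"
  proof (cases "a < t")
    case True
    then obtain z where "a < z" "z < t" "F t - F a = (t - a) * h z"
      using MVT2[of a t F h] hD(1) by blast
    then show ?thesis using that[of z] by auto
  next
    case nle: False
    then obtain z where "t < z" "z < a" "F a - F t = (a - t) * h z"
      using MVT2[of t a F h] hD(1) False by force
    then show ?thesis using that[of z] by (auto simp: algebra_simps)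
  qed
  have "\<bar>h \<eta> - h \<xi>\<bar> \<le> K * \<bar>\<eta> - \<xi>\<bar>"
    using hD(2,3)[of \<eta> \<xi>] hD(2,3)[of \<xi> \<eta>] by (cases "\<eta> \<le> \<xi>") auto
  also have "\<dots> \<le> K * (\<bar>t - a\<bar> + (b - a))"
    using \<xi> \<eta> \<open>K \<ge> 0\<close> by (intro mult_left_mono) auto
  finally have "\<bar>h \<eta>\<bar> \<le> \<bar>slope F a b\<bar> + K * (\<bar>t - a\<bar> + (b - a))" using slope by linarith
  then have "\<bar>t - a\<bar> * \<bar>h \<eta>\<bar> \<le> \<bar>t - a\<bar> * (\<bar>slope F a b\<bar> + K * (\<bar>t - a\<bar> + (b - a)))"
    by (intro mult_left_mono) auto
  then show ?thesis using \<eta>(2) by (simp add: abs_mult mult.commute)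
qed simp

lemma compact_box:
  fixes B :: "real \<Rightarrow> real"
  shows "compact {F :: real \<Rightarrow> real. \<forall>t. \<bar>F t\<bar> \<le> B t}"
proof -
  have "compact (PiE UNIV (\<lambda>t. {- B t..B t}))"
    using compactin_PiE[of "\<lambda>_::real. euclidean :: real topology" UNIV "\<lambda>t. {- B t..B t}"]
    by (simp add: euclidean_product_topology)
  moreover have "PiE UNIV (\<lambda>t. {- B t..B t}) = {F. \<forall>t. \<bar>F t\<bar> \<le> B t}"
    by (auto simp: PiE_UNIV_domain abs_le_iff minus_le_iff)
  ultimately show ?thesis by simp
qed

lemma closed_convex_plus:
  fixes G :: "real \<Rightarrow> real"
  shows "closed {F :: real \<Rightarrow> real. convex_on UNIV (\<lambda>t. G t + c * F t)}"
proof -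
  have "continuous_on UNIV (\<lambda>F :: real \<Rightarrow> real. F t)" for t by simp
  then show ?thesis
    unfolding convex_on_def Ball_def
    by (intro closed_Collect_conj closed_Collect_all closed_Collect_imp closed_Collect_le
        continuous_intros) (auto simp: open_Collect_const)
qed

text \<open>
  In the topology of pointwise convergence, the functions with curvature in \<open>[0, K]\<close> that have the
  prescribed values at \<open>a\<close> and \<open>b\<close> lie in a compact product of intervals, and each condition
  \<open>F t = f t\<close> is closed.
\<close>

lemma extension_by_compactness:
  fixes E :: "real set"
  assumes "K \<ge> 0" and ab: "a \<in> E" "b \<in> E" "a < b"
    and fin: "\<And>S. finite S \<Longrightarrow> S \<subseteq> E \<Longrightarrow> {a, b} \<subseteq> S \<Longrightarrow>
      \<exists>F h. curvature_within K F h \<and> (\<forall>t\<in>S. F t = f t)"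
  shows "\<exists>F h. curvature_within K F h \<and> (\<forall>t\<in>E. F t = f t)"
proof -
  define B where "B t = \<bar>f a\<bar> + (\<bar>slope f a b\<bar> + K * (\<bar>t - a\<bar> + (b - a))) * \<bar>t - a\<bar>" for t
  define Q where "Q = {F. \<exists>h. curvature_within K F h}"
  have Q: "Q = {F. convex_on UNIV (\<lambda>t. 0 + 1 * F t)} \<inter> {F. convex_on UNIV (\<lambda>t. K / 2 * t\<^sup>2 + (- 1) * F t)}"
    unfolding Q_def curvature_within_iff_convex by auto
  have "closed Q" unfolding Q by (intro closed_Int closed_convex_plus)
  then have compact: "compact ({F. \<forall>t. \<bar>F t\<bar> \<le> B t} \<inter> Q)" by (intro compact_Int_closed compact_box)
  have "({F. \<forall>t. \<bar>F t\<bar> \<le> B t} \<inter> Q) \<inter> (\<Inter>t\<in>E. {F. F t = f t}) \<noteq> {}"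
  proof (rule compact_imp_fip_image[OF compact])
    show "closed {F. F t = f t}" for t
      by (rule closed_Collect_eq) auto
  next
    fix S assume S: "finite S" "S \<subseteq> E"
    then obtain F h where F: "curvature_within K F h" "\<forall>t\<in>insert a (insert b S). F t = f t"
      using fin[of "insert a (insert b S)"] ab by auto
    have "\<bar>F t\<bar> \<le> B t" for t
    proof -
      have "slope F a b = slope f a b" using F(2) by (simp add: slope_def)
      then have "\<bar>F t - f a\<bar> \<le> B t - \<bar>f a\<bar>"
        using curvature_within_bound[OF F(1) \<open>K \<ge> 0\<close> \<open>a < b\<close>, of t] F(2) by (simp add: B_def)
      then show ?thesis by linarith
    qed
    then have "F \<in> ({F. \<forall>t. \<bar>F t\<bar> \<le> B t} \<inter> Q) \<inter> (\<Inter>t\<in>S. {F. F t = f t})"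
      using F by (auto simp: Q_def)
    then show "({F. \<forall>t. \<bar>F t\<bar> \<le> B t} \<inter> Q) \<inter> (\<Inter>t\<in>S. {F. F t = f t}) \<noteq> {}" by blast
  qed
  then show ?thesis by (auto simp: Q_def)
qed

theorem theorem8:
  fixes E :: "real set" and f :: "real \<Rightarrow> real" and M :: real
  assumes "compact E"
    and "M > 0"
    and "\<And>S. S \<subseteq> E \<Longrightarrow> finite S \<Longrightarrow> card S \<le> 5 \<Longrightarrow>
           \<exists>F \<in> C11c. (\<forall>x\<in>S. F x = f x) \<and> Lip (deriv F) \<le> ereal M"
  shows "\<exists>F \<in> C11c. (\<forall>x\<in>E. F x = f x) \<and> Lip (deriv F) \<le> ereal (2 * M)"
proof -
  have five: "\<exists>F h. curvature_within M F h \<and> (\<forall>t\<in>S. F t = f t)"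
    if "S \<subseteq> E" "finite S" "card S \<le> 5" for S
    using assms(3)[OF that] curvature_within_iff_C11c[of M] \<open>M > 0\<close> by (metis less_imp_le)
  have "\<exists>F h. curvature_within (2 * M) F h \<and> (\<forall>t\<in>E. F t = f t)"
  proof (cases "\<exists>a\<in>E. \<exists>b\<in>E. a < b")
    case True
    then obtain a b where ab: "a \<in> E" "b \<in> E" "a < b" by blast
    show ?thesis
    proof (rule extension_by_compactness[OF _ ab])
      fix S assume S: "finite S" "S \<subseteq> E" "{a, b} \<subseteq> S"
      then have "2 \<le> card S" using card_mono[OF S(1,3)] \<open>a < b\<close> by simp
      then obtain F h where "curvature_within (2 * M) F h" "\<And>t. t \<in> S \<Longrightarrow> F t = f t"
        using finite_extension[OF \<open>M > 0\<close> \<open>finite S\<close>, of f] five S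
        by (metis finite_subset subset_trans)
      then show "\<exists>F h. curvature_within (2 * M) F h \<and> (\<forall>t\<in>S. F t = f t)" by blast
    qed (use \<open>M > 0\<close> in simp)
  next
    case False
    then have "E \<subseteq> {t}" if "t \<in> E" for t using that by (auto intro: linorder_cases[of _ t])
    then consider "E = {}" | t where "E = {t}" by blast
    then have "finite E" "card E \<le> 5" by (cases; simp)+
    then obtain F h where F: "curvature_within M F h" "\<forall>t\<in>E. F t = f t" using five[of E] by blast
    have "K * d \<le> 2 * K * d" if "0 \<le> K" "0 \<le> d" for K d :: real using that by simp
    then have "curvature_within (2 * M) F h"
      using F(1) \<open>M > 0\<close> unfolding curvature_within_def
      by (meson diff_ge_0_iff_ge less_imp_le order_trans)
    then show ?thesis using F(2) by blast
  qed
  then show ?thesis using curvature_within_iff_C11c[of "2 * M"] \<open>M > 0\<close>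
    by (metis less_imp_le zero_less_mult_iff zero_less_numeral)
qed

end
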